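(* Let $d\ge 2$. The homogeneous ideal $\mathcal{I}(\mathcal{M}^{\exp}_d)\subseteq\mathbb{C}[m_0,\ldots,m_d]$ of the $d$th moment variety of the exponential distribution is generated by the maximal minors of $$H_d^{\exp}=\begin{pmatrix} m_0 & 2m_1 & 3m_2 & 4m_3&\cdots& dm_{d-1}\\ m_1 & m_2 & m_3 & m_4 &\cdots& m_{d} \end{pmatrix}.$$ In particular, $\mathcal{M}^{\exp}_d$ is a rational normal curve.
   Context: The moments of the exponential distribution are, as functions of its parameter $\lambda$, $m_i=i!\,\lambda^i$ for $i\ge 0$. The moment variety $\mathcal{M}^{\exp}_d\subseteq\mathbb{P}^d$ is the Zariski closure of the image of $\mathbb{C}\to\mathbb{P}^d$, $\lambda\mapsto[m_0(\lambda):m_1(\lambda):\cdots:m_d(\lambda)]$, and $\mathcal{I}(\cdot)$ denotes the homogeneous vanishing ideal. A rational normal curve in $\mathbb{P}^d$ is a curve projectively equivalent to the image of $\mathbb{P}^1\to\mathbb{P}^d$, $[s:t]\mapsto[s^d:s^{d-1}t:\cdots:t^d]$. *)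

theory Defs
  imports
    Complex_Main
    "HOL-Library.Poly_Mapping"
    "HOL-Algebra.Ideal"
    "Jordan_Normal_Form.Determinant"
    "Jordan_Normal_Form.DL_Submatrix"
begin

section \<open>Polynomials in the variables m_0, ..., m_d\<close>

text \<open>A monomial is its finitely supported exponent vector, a polynomial the finitely supported
  family of its coefficients. The type provides infinitely many variables; the ring for fixed
  \<open>d\<close> is cut out by its carrier.\<close>

type_synonym cpoly = "(nat \<Rightarrow>\<^sub>0 nat) \<Rightarrow>\<^sub>0 complex"

definition Var :: "nat \<Rightarrow> cpoly" where
  "Var i = Poly_Mapping.single (Poly_Mapping.single i 1) 1"

definition poly_ring :: "nat \<Rightarrow> cpoly ring" where
  "poly_ring d = \<lparr>
     carrier = {f. \<forall>a \<in> Poly_Mapping.keys f. Poly_Mapping.keys a \<subseteq> {..d}},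
     monoid.mult = (*), one = 1, zero = 0, add = (+)\<rparr>"

definition total_degree :: "(nat \<Rightarrow>\<^sub>0 nat) \<Rightarrow> nat" where
  "total_degree a = (\<Sum>i \<in> Poly_Mapping.keys a. Poly_Mapping.lookup a i)"

definition homogeneous :: "cpoly \<Rightarrow> bool" where
  "homogeneous f \<longleftrightarrow> (\<exists>n. \<forall>a \<in> Poly_Mapping.keys f. total_degree a = n)"

definition eval_poly :: "cpoly \<Rightarrow> complex vec \<Rightarrow> complex" where
  "eval_poly f v = (\<Sum>a \<in> Poly_Mapping.keys f. Poly_Mapping.lookup f a *
     (\<Prod>i \<in> Poly_Mapping.keys a. (v $ i) ^ Poly_Mapping.lookup a i))"

text \<open>The generated ideal \<open>Idl\<close> is an intersection over all ideals, so it is meaningful only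
  because \<open>poly_ring d\<close> is a ring.\<close>

lemma cring_poly_ring: "cring (poly_ring d)"
proof -
  let ?C = "{f :: cpoly. \<forall>a \<in> Poly_Mapping.keys f. Poly_Mapping.keys a \<subseteq> {..d}}"
  have plus: "f + g \<in> ?C" if "f \<in> ?C" "g \<in> ?C" for f g
    using that Poly_Mapping.keys_add[of f g] by blast
  have times: "f * g \<in> ?C" if fg: "f \<in> ?C" "g \<in> ?C" for f g
  proof (clarify)
    fix a i assume a: "a \<in> Poly_Mapping.keys (f * g)" and i: "i \<in> Poly_Mapping.keys a"
    obtain b c where "a = b + c" "b \<in> Poly_Mapping.keys f" "c \<in> Poly_Mapping.keys g"
      using a keys_mult[of f g] by blast
    then show "i \<le> d"
      using i fg Poly_Mapping.keys_add[of b c] by blast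
  qed
  have zero: "0 \<in> ?C" and one: "1 \<in> ?C" by simp_all
  have minus: "\<exists>g \<in> ?C. g + f = 0" if "f \<in> ?C" for f
    by (rule bexI[of _ "- f"]) (use that in simp_all)
  show ?thesis
  proof (rule cringI)
    show "abelian_group (poly_ring d)"
      by (rule abelian_groupI; unfold poly_ring_def ring_record_simps monoid.simps partial_object.simps)
         (assumption | rule plus zero minus add.assoc add.commute add_0_left)+
    show "Group.comm_monoid (poly_ring d)"
      by (rule comm_monoidI; unfold poly_ring_def ring_record_simps monoid.simps partial_object.simps)
         (assumption | rule times one mult.assoc mult.commute mult_1_left)+
  qed (simp add: poly_ring_def distrib_right)
qed

section \<open>Projective space and the Zariski topology\<close>

text \<open>A point is the set of all its representatives, a nonzero vector up to nonzero scalars.\<close>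

definition proj_pt :: "complex vec \<Rightarrow> complex vec set" where
  "proj_pt v = {c \<cdot>\<^sub>v v | c. c \<noteq> 0}"

definition proj_space :: "nat \<Rightarrow> complex vec set set" where
  "proj_space d = {proj_pt v | v. v \<in> carrier_vec (Suc d) \<and> v \<noteq> 0\<^sub>v (Suc d)}"

definition vanishes_at :: "cpoly \<Rightarrow> complex vec set \<Rightarrow> bool" where
  "vanishes_at f P \<longleftrightarrow> (\<forall>v \<in> P. eval_poly f v = 0)"

definition homogeneous_polys :: "nat \<Rightarrow> cpoly set" where
  "homogeneous_polys d = {f \<in> carrier (poly_ring d). homogeneous f}"

definition zero_locus :: "nat \<Rightarrow> cpoly set \<Rightarrow> complex vec set set" where
  "zero_locus d T = {P \<in> proj_space d. \<forall>f \<in> T. vanishes_at f P}"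

definition zariski_closed :: "nat \<Rightarrow> complex vec set set \<Rightarrow> bool" where
  "zariski_closed d Z \<longleftrightarrow> (\<exists>T \<subseteq> homogeneous_polys d. Z = zero_locus d T)"

definition vanishing_ideal :: "nat \<Rightarrow> complex vec set set \<Rightarrow> cpoly set" where
  "vanishing_ideal d X =
     Idl\<^bsub>poly_ring d\<^esub> {f \<in> homogeneous_polys d. \<forall>P \<in> X. vanishes_at f P}"

section \<open>Rational normal curves\<close>

definition standard_rational_normal_curve :: "nat \<Rightarrow> complex vec set set" where
  "standard_rational_normal_curve d =
     {proj_pt (vec (Suc d) (\<lambda>i. s ^ (d - i) * t ^ i)) | s t. (s, t) \<noteq> (0, 0)}"

definition projectively_equivalent ::
    "nat \<Rightarrow> complex vec set set \<Rightarrow> complex vec set set \<Rightarrow> bool" where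
  "projectively_equivalent d X Y \<longleftrightarrow>
     (\<exists>A \<in> carrier_mat (Suc d) (Suc d). invertible_mat A \<and> Y = (\<lambda>P. (\<lambda>v. A *\<^sub>v v) ` P) ` X)"

definition rational_normal_curve :: "nat \<Rightarrow> complex vec set set \<Rightarrow> bool" where
  "rational_normal_curve d X \<longleftrightarrow>
     projectively_equivalent d (standard_rational_normal_curve d) X"

section \<open>Moments of the exponential distribution\<close>

text \<open>The parameter is the mean: the density is \<open>exp (- x / \<lambda>) / \<lambda>\<close> on \<open>x \<ge> 0\<close> for
  real \<open>\<lambda> > 0\<close>. The moments are polynomial in \<open>\<lambda>\<close> and are extended to complex \<open>\<lambda>\<close>.\<close>

definition exp_moment :: "nat \<Rightarrow> complex \<Rightarrow> complex" where
  "exp_moment i l = fact i * l ^ i"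

definition exp_moment_variety :: "nat \<Rightarrow> complex vec set set" where
  "exp_moment_variety d =
     zariski_closed d hull {proj_pt (vec (Suc d) (\<lambda>i. exp_moment i l)) | l. True}"

definition maximal_minors :: "'a :: comm_ring_1 mat \<Rightarrow> 'a set" where
  "maximal_minors A =
     {det (submatrix A I J) | I J. I \<subseteq> {..<dim_row A} \<and> J \<subseteq> {..<dim_col A} \<and>
        card I = min (dim_row A) (dim_col A) \<and> card J = min (dim_row A) (dim_col A)}"

text \<open>Columns are numbered from 0, so the entry \<open>j m_(j-1)\<close> stands in column \<open>j - 1\<close>.\<close>

definition H_exp :: "nat \<Rightarrow> cpoly mat" where
  "H_exp d = mat 2 d (\<lambda>(i, j). if i = 0 then of_nat (Suc j) * Var j else Var (Suc j))"

end

theory Submission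
  imports Defs
begin

text \<open>Put \<open>x\<^sub>i = m\<^sub>i / i!\<close>. Up to units the minors are \<open>x\<^sub>j x\<^sub>k\<^sub>+\<^sub>1 - x\<^sub>k x\<^sub>j\<^sub>+\<^sub>1\<close>, so
  modulo them every monomial in the \<open>x\<^sub>i\<close> can be straightened to one that depends only on its
  degree and its weight (the sum of the indices). At the moment point of \<open>\<lambda>\<close> such a
  monomial takes the value \<open>\<lambda>\<close> to the power of its weight. Hence a homogeneous form that vanishes for all
  \<open>\<lambda>\<close> has vanishing coefficient sum in each weight, and lies in the ideal of the minors. So the moment
  variety is the zero locus of the minors, which is the standard rational normal curve scaled by
  \<open>diag (0!, \<dots>, d!)\<close>.\<close>

section \<open>Evaluation\<close>

text \<open>Evaluation at an arbitrary family \<open>g\<close> instead of a vector, so that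
  \<open>($) v\<close>, \<open>fact\<close> and the scaled powers \<open>c i * x ^ i\<close> are all
  covered.\<close>

definition mon_val :: "(nat \<Rightarrow> complex) \<Rightarrow> (nat \<Rightarrow>\<^sub>0 nat) \<Rightarrow> complex" where
  "mon_val g a = (\<Prod>i \<in> Poly_Mapping.keys a. g i ^ Poly_Mapping.lookup a i)"

definition weight :: "(nat \<Rightarrow>\<^sub>0 nat) \<Rightarrow> nat" where
  "weight a = (\<Sum>i \<in> Poly_Mapping.keys a. i * Poly_Mapping.lookup a i)"

lemma weight_add: "weight (a + b) = weight a + weight b"
  unfolding weight_def by (rule Poly_Mapping.setsum_keys_plus_distrib) (simp_all add: algebra_simps)

lemma total_degree_add: "total_degree (a + b) = total_degree a + total_degree b"
  unfolding total_degree_def by (rule Poly_Mapping.setsum_keys_plus_distrib) simp_all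

lemma weight_single [simp]: "weight (Poly_Mapping.single i n) = i * n"
  by (simp add: weight_def)

lemma total_degree_single [simp]: "total_degree (Poly_Mapping.single i n) = n"
  by (simp add: total_degree_def)

text \<open>Ensures that the weight of a monomial in \<open>m_0, ..., m_d\<close> is one that
  \<open>straight_mon\<close> can reach in the same degree.\<close>

lemma weight_le_total_degree: "Poly_Mapping.keys a \<subseteq> {..d} \<Longrightarrow> weight a \<le> total_degree a * d"
  unfolding weight_def total_degree_def sum_distrib_right
  by (rule sum_mono) (auto simp: mult.commute)

text \<open>Indices outside the support contribute \<open>g i ^ 0 = 1\<close>; this allows two
  monomials to be compared over one common index set.\<close>

lemma mon_val_superset:
  assumes "finite S" "Poly_Mapping.keys a \<subseteq> S"
  shows "mon_val g a = (\<Prod>i \<in> S. g i ^ Poly_Mapping.lookup a i)"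
  unfolding mon_val_def
  by (rule prod.mono_neutral_left) (use assms in \<open>auto simp: in_keys_iff\<close>)

lemma mon_val_add: "mon_val g (a + b) = mon_val g a * mon_val g b"
proof -
  let ?S = "Poly_Mapping.keys a \<union> Poly_Mapping.keys b"
  have "mon_val g (a + b) = (\<Prod>i \<in> ?S. g i ^ Poly_Mapping.lookup (a + b) i)"
    by (rule mon_val_superset) (use Poly_Mapping.keys_add[of a b] in auto)
  also have "\<dots> = mon_val g a * mon_val g b"
    by (simp add: mon_val_superset[of ?S] lookup_add power_add prod.distrib)
  finally show ?thesis .
qed

lemma mon_val_zero [simp]: "mon_val g 0 = 1"
  by (simp add: mon_val_def)

lemma mon_val_single [simp]: "mon_val g (Poly_Mapping.single i n) = g i ^ n"
  by (simp add: mon_val_def)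

lemma mon_val_fact_nonzero: "mon_val fact a \<noteq> 0"
  by (simp add: mon_val_def)

text \<open>With \<open>c = fact\<close> this is the value of a monomial at a moment point: the
  parameter enters only through the weight.\<close>

lemma mon_val_scaled_powers: "mon_val (\<lambda>i. c i * x ^ i) a = mon_val c a * x ^ weight a"
  by (simp add: mon_val_def weight_def power_mult_distrib prod.distrib power_sum power_mult)

lemma eval_poly_mon_val:
  "eval_poly f v = (\<Sum>a \<in> Poly_Mapping.keys f. Poly_Mapping.lookup f a * mon_val (($) v) a)"
  by (simp add: eval_poly_def mon_val_def)

lemma eval_poly_add: "eval_poly (f + g) v = eval_poly f v + eval_poly g v"
  unfolding eval_poly_mon_val
  by (rule Poly_Mapping.setsum_keys_plus_distrib) (simp_all add: distrib_right)

lemma eval_poly_zero [simp]: "eval_poly 0 v = 0"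
  by (simp add: eval_poly_mon_val)

lemma eval_poly_uminus: "eval_poly (- f) v = - eval_poly f v"
  using eval_poly_add[of f "- f" v] by (simp add: eq_neg_iff_add_eq_0 add.commute)

lemma eval_poly_diff: "eval_poly (f - g) v = eval_poly f v - eval_poly g v"
  using eval_poly_add[of f "- g" v] by (simp add: eval_poly_uminus)

lemma eval_poly_sum: "eval_poly (sum f S) v = (\<Sum>x \<in> S. eval_poly (f x) v)"
  by (induction S rule: infinite_finite_induct) (simp_all add: eval_poly_add)

lemma eval_poly_single [simp]: "eval_poly (Poly_Mapping.single a c) v = c * mon_val (($) v) a"
  by (simp add: eval_poly_mon_val)

lemma poly_eq_sum_singles:
  "f = (\<Sum>a \<in> Poly_Mapping.keys f. Poly_Mapping.single a (Poly_Mapping.lookup f a))"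
proof (rule poly_mapping_eqI)
  fix k
  show "Poly_Mapping.lookup f k = Poly_Mapping.lookup (\<Sum>a \<in> Poly_Mapping.keys f.
      Poly_Mapping.single a (Poly_Mapping.lookup f a)) k"
    by (cases "k \<in> Poly_Mapping.keys f")
       (auto simp: lookup_sum lookup_single when_def in_keys_iff)
qed

text \<open>Both factors are expanded into terms; multiplying terms adds exponent vectors, and
  \<open>mon_val\<close> turns that sum into a product.\<close>

lemma eval_poly_mult: "eval_poly (f * g) v = eval_poly f v * eval_poly g v"
proof -
  let ?s = "\<lambda>f a. Poly_Mapping.single a (Poly_Mapping.lookup f a)"
  have "f * g = (\<Sum>a \<in> Poly_Mapping.keys f. \<Sum>b \<in> Poly_Mapping.keys g. ?s f a * ?s g b)"
    by (subst poly_eq_sum_singles[of f], subst poly_eq_sum_singles[of g]) (rule sum_product)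
  then have "eval_poly (f * g) v =
      (\<Sum>a \<in> Poly_Mapping.keys f. \<Sum>b \<in> Poly_Mapping.keys g.
        (Poly_Mapping.lookup f a * mon_val (($) v) a) * (Poly_Mapping.lookup g b * mon_val (($) v) b))"
    by (simp add: eval_poly_sum mult_single mon_val_add mult_ac)
  then show ?thesis
    by (simp add: eval_poly_mon_val sum_product)
qed

section \<open>Ideals of the polynomial ring\<close>

abbreviation ring_carrier :: "nat \<Rightarrow> cpoly set" where
  "ring_carrier d \<equiv> carrier (poly_ring d)"

lemma ring_carrier_iff:
  "f \<in> ring_carrier d \<longleftrightarrow> (\<forall>a \<in> Poly_Mapping.keys f. Poly_Mapping.keys a \<subseteq> {..d})"
  by (simp add: poly_ring_def)

lemma poly_ring_ops:
  "x \<otimes>\<^bsub>poly_ring d\<^esub> y = x * y" "x \<oplus>\<^bsub>poly_ring d\<^esub> y = x + y" "\<zero>\<^bsub>poly_ring d\<^esub> = 0" "\<one>\<^bsub>poly_ring d\<^esub> = 1"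
  by (simp_all add: poly_ring_def)

lemma ring_poly_ring: "ring (poly_ring d)"
  using cring_poly_ring by (rule cring.axioms)

lemma ring_carrier_single:
  "Poly_Mapping.keys a \<subseteq> {..d} \<Longrightarrow> Poly_Mapping.single a c \<in> ring_carrier d"
  by (simp add: ring_carrier_iff)

lemma ring_carrier_mult: "f \<in> ring_carrier d \<Longrightarrow> g \<in> ring_carrier d \<Longrightarrow> f * g \<in> ring_carrier d"
  using monoid.m_closed[OF ring.is_monoid[OF ring_poly_ring], of f d g] by (simp add: poly_ring_ops)

lemma ring_carrier_one: "1 \<in> ring_carrier d"
  by (simp add: ring_carrier_iff)

lemma ring_carrier_diff: "f \<in> ring_carrier d \<Longrightarrow> g \<in> ring_carrier d \<Longrightarrow> f - g \<in> ring_carrier d"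
  using Poly_Mapping.keys_diff[of f g] unfolding ring_carrier_iff by blast

text \<open>Commutativity makes one-sided absorption enough, and negatives come from absorbing
  \<open>- 1\<close>.\<close>

lemma poly_idealI:
  assumes "I \<subseteq> ring_carrier d" "0 \<in> I"
    "\<And>f g. f \<in> I \<Longrightarrow> g \<in> I \<Longrightarrow> f + g \<in> I"
    "\<And>f g. f \<in> I \<Longrightarrow> g \<in> ring_carrier d \<Longrightarrow> g * f \<in> I"
  shows "ideal I (poly_ring d)"
proof (rule idealI[OF ring_poly_ring])
  show "subgroup I (add_monoid (poly_ring d))"
  proof (rule group.subgroupI)
    show "group (add_monoid (poly_ring d))"
      by (rule abelian_group.a_group[OF ring.is_abelian_group[OF ring_poly_ring]])
    fix f assume f: "f \<in> I"
    have m1: "- 1 \<in> ring_carrier d"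
      by (simp add: ring_carrier_iff)
    have "- f \<in> I" using assms(4)[OF f m1] by simp
    \<comment> \<open>The inverse in the additive group is given abstractly; uniqueness of inverses
      identifies it with \<open>- f\<close>.\<close>
    moreover have "inv\<^bsub>add_monoid (poly_ring d)\<^esub> f = - f"
    proof -
      have "\<ominus>\<^bsub>poly_ring d\<^esub> f = - f"
        using abelian_group.minus_equality[OF ring.is_abelian_group[OF ring_poly_ring], of d "- f" f]
          f assms(1) \<open>- f \<in> I\<close> by (auto simp: poly_ring_ops)
      then show ?thesis by (simp add: a_inv_def)
    qed
    ultimately show "inv\<^bsub>add_monoid (poly_ring d)\<^esub> f \<in> I" by simp
  qed (use assms(1-3) in \<open>auto simp: poly_ring_ops\<close>)
qed (use assms in \<open>auto simp: poly_ring_ops mult.commute\<close>)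

text \<open>An ideal to compare with: \<open>Idl\<close> is the least ideal containing its
  generators, so it lies in this one once they all vanish at \<open>v\<close>.\<close>

lemma eval_kernel_ideal: "ideal {f \<in> ring_carrier d. eval_poly f v = 0} (poly_ring d)"
proof (rule poly_idealI)
  fix f g
  assume "f \<in> {f \<in> ring_carrier d. eval_poly f v = 0}" "g \<in> {f \<in> ring_carrier d. eval_poly f v = 0}"
  then show "f + g \<in> {f \<in> ring_carrier d. eval_poly f v = 0}"
    using abelian_monoid.a_closed[OF abelian_group.axioms(1)[OF ring.is_abelian_group[OF ring_poly_ring]], of f d g]
    by (simp add: poly_ring_ops eval_poly_add)
qed (auto simp: eval_poly_mult ring_carrier_mult ring_carrier_iff[of 0])

section \<open>The maximal minors\<close>

definition minor :: "nat \<Rightarrow> nat \<Rightarrow> cpoly" where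
  "minor j k = of_nat (Suc j) * Var j * Var (Suc k) - of_nat (Suc k) * Var k * Var (Suc j)"

lemma minor_eq_singles:
  "minor j k =
     Poly_Mapping.single (Poly_Mapping.single j 1 + Poly_Mapping.single (Suc k) 1) (of_nat (Suc j)) -
     Poly_Mapping.single (Poly_Mapping.single k 1 + Poly_Mapping.single (Suc j) 1) (of_nat (Suc k))"
  unfolding minor_def Var_def single_of_nat[symmetric] mult_single by simp

lemma det_2_by_2:
  fixes A :: "'a :: comm_ring_1 mat"
  assumes "A \<in> carrier_mat 2 2"
  shows "det A = A $$ (0, 0) * A $$ (1, 1) - A $$ (0, 1) * A $$ (1, 0)"
proof -
  \<comment> \<open>Deleting row 0 and column \<open>j\<close> leaves a single entry, in the other
    column \<open>1 - j\<close>.\<close>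
  have del: "det (mat_delete A 0 j) = A $$ (1, 1 - j)" if "j < 2" for j
    using that assms by (subst det_single) (auto simp: mat_delete_def less_2_cases_iff)
  have "det A = (\<Sum>j<2. A $$ (0, j) * cofactor A 0 j)"
    by (rule laplace_expansion_row[OF assms]) simp
  then show ?thesis
    by (simp add: numeral_2_eq_2 cofactor_def del)
qed

text \<open>\<open>submatrix\<close> lists the kept columns in increasing order, so
  \<open>j < k\<close> fixes the sign of the determinant.\<close>

lemma det_submatrix_two_rows:
  fixes A :: "'a :: comm_ring_1 mat"
  assumes A: "dim_row A = 2" "I \<subseteq> {..<2}" "card I = 2" and J: "j < k" "k < dim_col A"
  shows "det (submatrix A I {j, k}) = A $$ (0, j) * A $$ (1, k) - A $$ (0, k) * A $$ (1, j)"
proof -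
  have I: "I = {0, 1}"
    using card_subset_eq[of "{..<2}" I] A by auto
  let ?B = "submatrix A I {j, k}"
  have I': "{i. i < dim_row A \<and> i \<in> I} = {0, 1}" and J': "{i. i < dim_col A \<and> i \<in> {j, k}} = {j, k}"
    using I A J by auto
  have c: "?B \<in> carrier_mat 2 2"
    by (rule carrier_matI; unfold dim_submatrix I' J') (use J in simp_all)
  have p: "pick I 0 = 0" "pick I 1 = 1" "pick {j, k} 0 = j" "pick {j, k} 1 = k"
  proof -
    show p0: "pick I 0 = 0" "pick {j, k} 0 = j"
      unfolding I using J by (auto intro!: Least_equality)
    \<comment> \<open>After the minimum, \<open>pick\<close> takes the least element above the
      previous pick.\<close>
    show "pick I 1 = 1" "pick {j, k} 1 = k"
      using p0 J unfolding I One_nat_def DL_Missing_Sublist.pick.simps(2)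
      by (auto intro!: Least_equality)
  qed
  have e: "?B $$ (a, b) = A $$ (pick I a, pick {j, k} b)" if "a < 2" "b < 2" for a b
    by (rule submatrix_index; unfold I' J') (use J that in simp_all)
  show ?thesis
    using c p by (simp add: det_2_by_2[OF c] e mult.commute)
qed

text \<open>Since \<open>d \<ge> 2\<close>, the smaller dimension is 2: a maximal minor uses both
  rows and a pair of columns, which can be sorted.\<close>

lemma maximal_minors_H_exp:
  assumes "d \<ge> 2"
  shows "maximal_minors (H_exp d) = {minor j k | j k. j < k \<and> k < d}"
proof -
  have H: "dim_row (H_exp d) = 2" "dim_col (H_exp d) = d"
    by (simp_all add: H_exp_def)
  have det: "det (submatrix (H_exp d) I {j, k}) = minor j k"
    if "I \<subseteq> {..<2}" "card I = 2" "j < k" "k < d" for I j k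
    using det_submatrix_two_rows[of "H_exp d" I j k] that
    by (simp add: H) (simp add: H_exp_def minor_def)
  have two: "\<exists>j k. J = {j, k} \<and> j < k \<and> k < d" if "J \<subseteq> {..<d}" "card J = 2" for J
  proof -
    obtain x y where "J = {x, y}" "x \<noteq> y"
      using \<open>card J = 2\<close> by (auto simp: card_2_iff)
    then show ?thesis
      using that(1) by (metis insert_commute insert_subset lessThan_iff linorder_neqE_nat)
  qed
  show ?thesis
  proof (rule subset_antisym; rule subsetI)
    fix f assume "f \<in> maximal_minors (H_exp d)"
    then obtain I J where f: "f = det (submatrix (H_exp d) I J)" "I \<subseteq> {..<2}" "card I = 2"
        "J \<subseteq> {..<d}" "card J = 2"
      using assms unfolding maximal_minors_def H by (auto simp: min_def)
    from two[OF f(4,5)] det[OF f(2,3)] f(1) show "f \<in> {minor j k | j k. j < k \<and> k < d}"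
      by blast
  next
    fix f assume "f \<in> {minor j k | j k. j < k \<and> k < d}"
    then obtain j k where f: "f = minor j k" "j < k" "k < d" by blast
    have "f = det (submatrix (H_exp d) {..<2} {j, k})"
      using det[of "{..<2}" j k] f by simp
    moreover have "{j, k} \<subseteq> {..<d}" "card {j, k} = 2"
      using f by auto
    ultimately show "f \<in> maximal_minors (H_exp d)"
      unfolding maximal_minors_def H using assms
      by (intro CollectI exI[of _ "{..<2}"] exI[of _ "{j, k}"]) (simp add: min_def)
  qed
qed

section \<open>Straightening modulo the minors\<close>

text \<open>The coordinate \<open>x\<^sub>i\<close> of the overview. Its value at the moment point
  of \<lambda> is the plain power \<open>\<lambda>^i\<close>, so factorials disappear from the
  relations.\<close>

definition scaled_var :: "nat \<Rightarrow> cpoly" where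
  "scaled_var i = Poly_Mapping.single (Poly_Mapping.single i 1) (1 / fact i)"

lemma scaled_var_carrier: "i \<le> d \<Longrightarrow> scaled_var i \<in> ring_carrier d"
  by (simp add: scaled_var_def ring_carrier_single)

text \<open>The representative of degree \<open>n\<close> and weight \<open>w\<close>, of the form \<open>x\<^sub>d \<cdots> x\<^sub>d x\<^sub>i x\<^sub>0 \<cdots> x\<^sub>0\<close>;
  it has weight \<open>w\<close> only if \<open>w \<le> n * d\<close>.\<close>

primrec straight_mon :: "nat \<Rightarrow> nat \<Rightarrow> nat \<Rightarrow> cpoly" where
  "straight_mon d 0 w = 1"
| "straight_mon d (Suc n) w = scaled_var (min d w) * straight_mon d n (w - min d w)"

lemma straight_mon_carrier: "straight_mon d n w \<in> ring_carrier d"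
  by (induction n arbitrary: w) (simp_all add: ring_carrier_one ring_carrier_mult scaled_var_carrier)

text \<open>The constant is a unit, and cancelling \<open>j + 1\<close> against
  \<open>(j + 1)!\<close> (likewise for \<open>k\<close>) produces the coefficients of the two
  products on the left.\<close>

lemma scaled_minor:
  "scaled_var j * scaled_var (Suc k) - scaled_var k * scaled_var (Suc j) =
     Poly_Mapping.single 0 (1 / (fact (Suc j) * fact (Suc k))) * minor j k"
proof -
  have "1 / (fact j * fact (Suc k)) = 1 / (fact (Suc j) * fact (Suc k)) * (of_nat (Suc j) :: complex)"
       "1 / (fact k * fact (Suc j)) = 1 / (fact (Suc j) * fact (Suc k)) * (of_nat (Suc k) :: complex)"
    by (simp_all del: of_nat_Suc add: fact_Suc field_simps)
  then show ?thesis
    unfolding scaled_var_def minor_eq_singles right_diff_distrib mult_single by simp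
qed

text \<open>Straightening uses only that the minors lie in some ideal of the ring; later
  \<open>I\<close> becomes the ideal they generate.\<close>

locale minor_ideal =
  fixes d :: nat and I :: "cpoly set"
  assumes ideal_I: "ideal I (poly_ring d)"
    and minor_in_I: "j < k \<Longrightarrow> k < d \<Longrightarrow> minor j k \<in> I"
begin

section \<open>Congruence modulo the ideal\<close>

lemma zero_in_I: "0 \<in> I"
  using additive_subgroup.zero_closed[OF ideal.axioms(1)[OF ideal_I]] by (simp add: poly_ring_ops)

lemma add_in_I: "f \<in> I \<Longrightarrow> g \<in> I \<Longrightarrow> f + g \<in> I"
  using additive_subgroup.a_closed[OF ideal.axioms(1)[OF ideal_I], of f g] by (simp add: poly_ring_ops)

lemma mult_in_I: "g \<in> ring_carrier d \<Longrightarrow> f \<in> I \<Longrightarrow> g * f \<in> I"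
  using ideal.I_l_closed[OF ideal_I, of f g] by (simp add: poly_ring_ops)

lemma uminus_in_I: "f \<in> I \<Longrightarrow> - f \<in> I"
  using mult_in_I[of "- 1" f] by (simp add: ring_carrier_iff)

lemma sum_in_I: "(\<And>x. x \<in> S \<Longrightarrow> f x \<in> I) \<Longrightarrow> sum f S \<in> I"
  by (induction S rule: infinite_finite_induct) (simp_all add: zero_in_I add_in_I)

definition cong_I :: "cpoly \<Rightarrow> cpoly \<Rightarrow> bool" (infix "\<simeq>" 50) where
  "f \<simeq> g \<longleftrightarrow> f - g \<in> I"

lemma cong_refl [simp]: "f \<simeq> f"
  by (simp add: cong_I_def zero_in_I)

lemma cong_sym: "f \<simeq> g \<Longrightarrow> g \<simeq> f"
  using uminus_in_I[of "f - g"] by (simp add: cong_I_def)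

lemma cong_trans [trans]: "f \<simeq> g \<Longrightarrow> g \<simeq> h \<Longrightarrow> f \<simeq> h"
  using add_in_I[of "f - g" "g - h"] by (simp add: cong_I_def)

lemma cong_mult_left: "h \<in> ring_carrier d \<Longrightarrow> f \<simeq> g \<Longrightarrow> h * f \<simeq> h * g"
  using mult_in_I[of h "f - g"] by (simp add: cong_I_def right_diff_distrib)

lemma cong_mult_right: "h \<in> ring_carrier d \<Longrightarrow> f \<simeq> g \<Longrightarrow> f * h \<simeq> g * h"
  using cong_mult_left[of h f g] by (simp add: mult.commute)

text \<open>A minor moves one unit of index from one factor to the other. For \<open>j = k\<close>
  both sides agree, and for \<open>k < j\<close> the minor is read backwards.\<close>

lemma scaled_var_exchange:
  assumes "j < d" "k < d"
  shows "scaled_var j * scaled_var (Suc k) \<simeq> scaled_var (Suc j) * scaled_var k"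
proof -
  have less: "scaled_var i * scaled_var (Suc l) \<simeq> scaled_var l * scaled_var (Suc i)"
    if "i < l" "l < d" for i l
    unfolding cong_I_def scaled_minor
    by (rule mult_in_I) (simp_all add: ring_carrier_single minor_in_I that)
  consider "j < k" | "j = k" | "k < j" by linarith
  then show ?thesis
    by cases (use less[of j k] cong_sym[OF less[of k j]] assms in \<open>simp_all add: mult.commute\<close>)
qed

text \<open>Units are moved from \<open>p\<close> to \<open>q\<close> until the first index is 0;
  the bound keeps the second index at most \<open>d\<close>.\<close>

lemma scaled_var_collapse_low:
  "p + q \<le> d \<Longrightarrow> scaled_var p * scaled_var q \<simeq> scaled_var (p + q) * scaled_var 0"
proof (induction p arbitrary: q)
  case 0
  then show ?case by (simp add: mult.commute)
next
  case (Suc p)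
  have "scaled_var (Suc p) * scaled_var q \<simeq> scaled_var p * scaled_var (Suc q)"
    by (rule cong_sym, rule scaled_var_exchange) (use Suc.prems in auto)
  also have "\<dots> \<simeq> scaled_var (Suc p + q) * scaled_var 0"
    using Suc.IH[of "Suc q"] Suc.prems by simp
  finally show ?case .
qed

text \<open>Units are moved from \<open>q\<close> to \<open>p\<close> until the first index is
  \<open>d\<close>; \<open>d \<le> p + q\<close> means that \<open>q\<close> has enough to
  give.\<close>

lemma scaled_var_collapse_high:
  "p \<le> d \<Longrightarrow> q \<le> d \<Longrightarrow> d \<le> p + q \<Longrightarrow>
     scaled_var p * scaled_var q \<simeq> scaled_var d * scaled_var (p + q - d)"
proof (induction "d - p" arbitrary: p q)
  case 0
  then show ?case by simp
next
  case (Suc n)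
  \<comment> \<open>Here \<open>p < d \<le> p + q\<close>, so \<open>q\<close> is positive.\<close>
  then obtain r where q: "q = Suc r"
    by (cases q) auto
  have "scaled_var p * scaled_var q \<simeq> scaled_var (Suc p) * scaled_var r"
    unfolding q by (rule scaled_var_exchange) (use Suc q in auto)
  also have "\<dots> \<simeq> scaled_var d * scaled_var (Suc p + r - d)"
    by (rule Suc.hyps(1)) (use Suc q in auto)
  finally show ?case by (simp add: q)
qed

text \<open>If \<open>d \<le> w\<close>, the representative starts with \<open>x\<^sub>d\<close>,
  which is set aside for the induction. Otherwise it is \<open>x\<^sub>w\<close> followed by copies
  of \<open>x\<^sub>0\<close>, and only the pair \<open>x\<^sub>i x\<^sub>w\<close> has to be
  collapsed, low or high.\<close>

lemma straight_mon_step: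
  "i \<le> d \<Longrightarrow> w \<le> n * d \<Longrightarrow> scaled_var i * straight_mon d n w \<simeq> straight_mon d (Suc n) (w + i)"
proof (induction n arbitrary: w)
  case 0
  then show ?case by (simp add: min_def)
next
  case (Suc n)
  show ?case
  proof (cases "d \<le> w")
    case True
    have "scaled_var i * straight_mon d (Suc n) w = scaled_var d * (scaled_var i * straight_mon d n (w - d))"
      using True by (simp add: min_def mult_ac)
    also have "\<dots> \<simeq> scaled_var d * straight_mon d (Suc n) (w - d + i)"
      by (intro cong_mult_left scaled_var_carrier Suc.IH) (use Suc.prems in auto)
    also have "\<dots> = straight_mon d (Suc (Suc n)) (w + i)"
      using True by (simp add: min_def)
    finally show ?thesis .
  next
    case False
    then have *: "scaled_var i * straight_mon d (Suc n) w = scaled_var i * scaled_var w * straight_mon d n 0"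
      by (simp add: min_def mult_ac)
    show ?thesis
    proof (cases "i + w \<le> d")
      case True
      have "scaled_var i * scaled_var w * straight_mon d n 0 \<simeq>
          scaled_var (i + w) * scaled_var 0 * straight_mon d n 0"
        by (intro cong_mult_right straight_mon_carrier scaled_var_collapse_low True)
      also have "\<dots> = straight_mon d (Suc (Suc n)) (w + i)"
        using True by (simp add: min_def mult_ac add.commute)
      finally show ?thesis by (simp only: *)
    next
      case high: False
      have "scaled_var i * scaled_var w * straight_mon d n 0 \<simeq>
          scaled_var d * scaled_var (i + w - d) * straight_mon d n 0"
        by (intro cong_mult_right straight_mon_carrier scaled_var_collapse_high)
           (use high False Suc.prems in auto)
      also have "\<dots> = straight_mon d (Suc (Suc n)) (w + i)"
        using high False Suc.prems by (auto simp: min_def mult_ac add.commute)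
      finally show ?thesis by (simp only: *)
    qed
  qed
qed

text \<open>The factor \<open>1 / mon_val fact a\<close> turns the monomial into a product of the
  \<open>x\<^sub>i\<close>, whose variables are then absorbed one at a time by
  \<open>straight_mon_step\<close>.\<close>

lemma monomial_straighten:
  "Poly_Mapping.keys a \<subseteq> {..d} \<Longrightarrow>
     Poly_Mapping.single a (1 / mon_val fact a) \<simeq> straight_mon d (total_degree a) (weight a)"
proof (induction "total_degree a" arbitrary: a)
  case 0
  have "a = 0"
  proof (rule poly_mapping_eqI)
    fix i
    show "Poly_Mapping.lookup a i = Poly_Mapping.lookup 0 i"
      using 0 by (cases "i \<in> Poly_Mapping.keys a") (auto simp: total_degree_def in_keys_iff)
  qed
  then show ?case
    by (simp add: total_degree_def)
next
  case (Suc n)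
  have "a \<noteq> 0"
    using Suc.hyps(2) by (auto simp: total_degree_def)
  then obtain i where i: "i \<in> Poly_Mapping.keys a"
    by (metis keys_eq_empty ex_in_conv)
  \<comment> \<open>The exponent of \<open>i\<close> is positive, so the truncated subtraction loses
    nothing.\<close>
  define b where "b = a - Poly_Mapping.single i 1"
  have ab: "a = b + Poly_Mapping.single i 1"
    using i by (intro poly_mapping_eqI)
      (auto simp: b_def lookup_add lookup_minus lookup_single when_def in_keys_iff)
  have b: "Poly_Mapping.keys b \<subseteq> {..d}"
    using Suc.prems by (auto simp: b_def in_keys_iff lookup_minus subset_iff)
  have n: "n = total_degree b"
    using Suc.hyps(2) by (simp add: ab total_degree_add)
  have id: "i \<le> d"
    using Suc.prems i by auto
  have "Poly_Mapping.single a (1 / mon_val fact a) =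
      scaled_var i * Poly_Mapping.single b (1 / mon_val fact b)"
    by (simp add: scaled_var_def mult_single ab mon_val_add add.commute mult.commute)
  also have "\<dots> \<simeq> scaled_var i * straight_mon d (total_degree b) (weight b)"
    by (intro cong_mult_left scaled_var_carrier id Suc.hyps(1) n b)
  also have "\<dots> \<simeq> straight_mon d (Suc (total_degree b)) (weight b + i)"
    by (intro straight_mon_step id weight_le_total_degree b)
  also have "\<dots> = straight_mon d (total_degree a) (weight a)"
    by (simp add: ab weight_add total_degree_add)
  finally show ?case .
qed

text \<open>All monomials of \<open>f\<close> have the same degree, so those of equal weight share
  one representative. Vanishing on the curve makes their coefficients cancel weight by
  weight.\<close>

lemma homogeneous_vanishing_in_I:
  assumes f: "f \<in> ring_carrier d" "homogeneous f"
    and van: "\<And>l. eval_poly f (vec (Suc d) (\<lambda>i. exp_moment i l)) = 0"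
  shows "f \<in> I"
proof -
  let ?K = "Poly_Mapping.keys f"
  \<comment> \<open>The coefficients of \<open>f\<close> when it is written in the
    \<open>x\<^sub>i\<close>.\<close>
  define c where "c a = Poly_Mapping.lookup f a * mon_val fact a" for a
  obtain n where n: "\<And>a. a \<in> ?K \<Longrightarrow> total_degree a = n"
    using f(2) by (auto simp: homogeneous_def)
  have keys: "Poly_Mapping.keys a \<subseteq> {..d}" if "a \<in> ?K" for a
    using f(1) that by (simp add: ring_carrier_iff)
  \<comment> \<open>The restriction of \<open>f\<close> to the moment curve, as a polynomial in
    \<lambda>.\<close>
  define P where "P = (\<Sum>a \<in> ?K. monom (c a) (weight a))"
  have "poly P l = 0" for l
  proof -
    let ?v = "vec (Suc d) (\<lambda>i. exp_moment i l)"
    have "mon_val (($) ?v) a = mon_val fact a * l ^ weight a" if "a \<in> ?K" for a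
    proof -
      have "mon_val (($) ?v) a = mon_val (\<lambda>i. fact i * l ^ i) a"
        unfolding mon_val_def by (rule prod.cong) (use keys[OF that] in \<open>auto simp: exp_moment_def\<close>)
      then show ?thesis by (simp add: mon_val_scaled_powers)
    qed
    then have "eval_poly f ?v = poly P l"
      by (simp add: eval_poly_mon_val P_def poly_sum poly_monom c_def mult.assoc)
    then show ?thesis by (simp add: van)
  qed
  then have "P = 0"
    using poly_all_0_iff_0 by blast
  have coeff: "(\<Sum>a \<in> {a \<in> ?K. weight a = w}. c a) = 0" for w
  proof -
    have "(\<Sum>a \<in> {a \<in> ?K. weight a = w}. c a) = coeff P w"
      by (simp add: P_def coeff_sum sum.inter_filter)
    then show ?thesis by (simp add: \<open>P = 0\<close>)
  qed
  have sing: "Poly_Mapping.single 0 (sum g S) = (\<Sum>a \<in> S. Poly_Mapping.single (0 :: nat \<Rightarrow>\<^sub>0 nat) (g a :: complex))"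
    for g :: "(nat \<Rightarrow>\<^sub>0 nat) \<Rightarrow> complex" and S
    by (induction S rule: infinite_finite_induct) (simp_all add: single_add)
  let ?C = "\<lambda>a. Poly_Mapping.single (0 :: nat \<Rightarrow>\<^sub>0 nat) (c a)"
  \<comment> \<open>Grouping by weight pulls out the common representative and leaves the
    coefficient sums, which are zero.\<close>
  have "(\<Sum>a \<in> ?K. ?C a * straight_mon d n (weight a)) =
      (\<Sum>w \<in> weight ` ?K. \<Sum>a \<in> {a \<in> ?K. weight a = w}. ?C a * straight_mon d n (weight a))"
    by (rule sum.image_gen) simp
  also have "\<dots> = (\<Sum>w \<in> weight ` ?K. (\<Sum>a \<in> {a \<in> ?K. weight a = w}. ?C a) * straight_mon d n w)"
    by (simp add: sum_distrib_right)
  also have "\<dots> = 0"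
    by (simp add: sing[symmetric] coeff)
  finally have zero: "(\<Sum>a \<in> ?K. ?C a * straight_mon d n (weight a)) = 0" .
  have split: "Poly_Mapping.single a (Poly_Mapping.lookup f a) =
      ?C a * Poly_Mapping.single a (1 / mon_val fact a)" for a
    by (simp add: mult_single c_def mon_val_fact_nonzero)
  \<comment> \<open>Subtracting this zero sum exhibits \<open>f\<close> as a sum of differences
    between a term and its representative.\<close>
  have "f = f - (\<Sum>a \<in> ?K. ?C a * straight_mon d n (weight a))"
    by (simp add: zero)
  also have "\<dots> = (\<Sum>a \<in> ?K. Poly_Mapping.single a (Poly_Mapping.lookup f a) -
      ?C a * straight_mon d n (weight a))"
    by (subst (1) poly_eq_sum_singles[of f]) (simp add: sum_subtractf)
  also have "\<dots> \<in> I"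
  proof (rule sum_in_I)
    fix a assume a: "a \<in> ?K"
    have "?C a * Poly_Mapping.single a (1 / mon_val fact a) \<simeq> ?C a * straight_mon d n (weight a)"
      using monomial_straighten[OF keys[OF a]] n[OF a]
      by (intro cong_mult_left ring_carrier_single) simp_all
    then show "Poly_Mapping.single a (Poly_Mapping.lookup f a) - ?C a * straight_mon d n (weight a) \<in> I"
      unfolding split by (simp add: cong_I_def)
  qed
  finally show ?thesis .
qed

end

section \<open>The moment curve\<close>

abbreviation minors :: "nat \<Rightarrow> cpoly set" where
  "minors d \<equiv> {minor j k | j k. j < k \<and> k < d}"

lemma eval_minor:
  "eval_poly (minor j k) v =
     of_nat (Suc j) * (v $ j * v $ Suc k) - of_nat (Suc k) * (v $ k * v $ Suc j)"
  unfolding minor_eq_singles eval_poly_diff eval_poly_single mon_val_add mon_val_single by simp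

lemma minors_homogeneous_polys: "minors d \<subseteq> homogeneous_polys d"
proof clarify
  fix j k assume "j < k" "k < d"
  let ?a = "Poly_Mapping.single j (1 :: nat) + Poly_Mapping.single (Suc k) 1"
  let ?b = "Poly_Mapping.single k (1 :: nat) + Poly_Mapping.single (Suc j) 1"
  have keys: "Poly_Mapping.keys ?a \<subseteq> {..d}" "Poly_Mapping.keys ?b \<subseteq> {..d}"
    using Poly_Mapping.keys_add[of "Poly_Mapping.single j (1 :: nat)" "Poly_Mapping.single (Suc k) 1"]
      Poly_Mapping.keys_add[of "Poly_Mapping.single k (1 :: nat)" "Poly_Mapping.single (Suc j) 1"]
      \<open>j < k\<close> \<open>k < d\<close> by auto
  have "minor j k \<in> ring_carrier d"
    unfolding minor_eq_singles by (intro ring_carrier_diff ring_carrier_single keys)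
  moreover have "total_degree m = 2" if "m \<in> Poly_Mapping.keys (minor j k)" for m
  proof -
    have "m \<in> {?a, ?b}"
      using that Poly_Mapping.keys_diff[of "Poly_Mapping.single ?a (of_nat (Suc j) :: complex)"
          "Poly_Mapping.single ?b (of_nat (Suc k))"]
      unfolding minor_eq_singles keys_single by (auto split: if_splits)
    then show ?thesis
      by (auto simp: total_degree_add)
  qed
  ultimately show "minor j k \<in> homogeneous_polys d"
    unfolding homogeneous_polys_def homogeneous_def by blast
qed

lemma minors_carrier: "minors d \<subseteq> ring_carrier d"
  using minors_homogeneous_polys by (auto simp: homogeneous_polys_def)

lemma minor_ideal_genideal: "minor_ideal d (Idl\<^bsub>poly_ring d\<^esub> (minors d))"
proof (rule minor_ideal.intro)
  show "ideal (Idl\<^bsub>poly_ring d\<^esub> (minors d)) (poly_ring d)"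
    by (rule ring.genideal_ideal[OF ring_poly_ring minors_carrier])
  show "minor j k \<in> Idl\<^bsub>poly_ring d\<^esub> (minors d)" if "j < k" "k < d" for j k
    using ring.genideal_self[OF ring_poly_ring minors_carrier, of d] that by blast
qed

lemma eval_genideal_zero:
  assumes "S \<subseteq> ring_carrier d" "\<And>g. g \<in> S \<Longrightarrow> eval_poly g v = 0"
    and "f \<in> Idl\<^bsub>poly_ring d\<^esub> S"
  shows "eval_poly f v = 0"
  using ring.genideal_minimal[OF ring_poly_ring eval_kernel_ideal, of S d v] assms by blast

section \<open>The curve cut out by the minors\<close>

lemma in_proj_pt: "v \<in> proj_pt v"
  unfolding proj_pt_def by (rule CollectI, rule exI[of _ 1]) simp

lemma proj_pt_smult:
  assumes "c \<noteq> 0"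
  shows "proj_pt (c \<cdot>\<^sub>v v) = proj_pt v"
proof -
  have "\<exists>e. a \<cdot>\<^sub>v v = e \<cdot>\<^sub>v (c \<cdot>\<^sub>v v) \<and> e \<noteq> 0" if "a \<noteq> 0" for a
    using that assms by (intro exI[of _ "a / c"]) (simp add: smult_smult_assoc)
  then show ?thesis
    unfolding proj_pt_def using assms by (fastforce simp: smult_smult_assoc)
qed

text \<open>The standard parametrisation scaled by \<open>diag (0!, ..., d!)\<close>. The chart
  \<open>s = 1\<close> consists of the moment points; \<open>s = 0\<close> is the point at infinity,
  \<open>[0 : ... : 0 : 1]\<close>.\<close>

definition curve_vec :: "nat \<Rightarrow> complex \<Rightarrow> complex \<Rightarrow> complex vec" where
  "curve_vec d s t = vec (Suc d) (\<lambda>i. fact i * (s ^ (d - i) * t ^ i))"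

lemma curve_vec_nonzero:
  assumes "(s, t) \<noteq> (0, 0)"
  shows "curve_vec d s t \<noteq> 0\<^sub>v (Suc d)"
proof
  assume *: "curve_vec d s t = 0\<^sub>v (Suc d)"
  have "curve_vec d s t $ 0 = 0" "curve_vec d s t $ d = 0"
    unfolding * by simp_all
  then show False
    using assms by (auto simp: curve_vec_def)
qed

lemma minor_zero_on_curve:
  assumes "j < d" "k < d"
  shows "eval_poly (minor j k) (c \<cdot>\<^sub>v curve_vec d s t) = 0"
proof -
  \<comment> \<open>With the truncated differences in successor form, both products visibly carry
    the same power of \<open>s\<close>.\<close>
  have m: "d - j = Suc (d - Suc j)" "d - k = Suc (d - Suc k)"
    using assms by simp_all
  show ?thesis
    using assms unfolding eval_minor by (simp add: curve_vec_def m algebra_simps)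
qed

text \<open>In the coordinates \<open>y i\<close> the relations make consecutive ratios constant if
  \<open>y 0\<close> is nonzero; otherwise they leave only the last coordinate, which is the point
  at infinity.\<close>

lemma zero_of_minors_on_curve:
  assumes v: "v \<in> carrier_vec (Suc d)" "v \<noteq> 0\<^sub>v (Suc d)" and "d \<ge> 2"
    and zero: "\<And>j k. j < k \<Longrightarrow> k < d \<Longrightarrow> eval_poly (minor j k) v = 0"
  obtains c s t where "c \<noteq> 0" "(s, t) \<noteq> (0, 0)" "v = c \<cdot>\<^sub>v curve_vec d s t"
proof -
  define y where "y i = v $ i / fact i" for i
  have vy: "v $ i = fact i * y i" for i
    by (simp add: y_def)
  have rel: "y j * y (Suc k) = y k * y (Suc j)" if "j < k" "k < d" for j k
  proof -
    \<comment> \<open>This multiple is exactly the value of the minor at \<open>v\<close>.\<close>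
    have "fact (Suc j) * fact (Suc k) * (y j * y (Suc k) - y k * y (Suc j)) = 0"
      using zero[OF that] unfolding eval_minor vy fact_Suc by (simp add: algebra_simps)
    then show ?thesis by (simp del: fact_Suc)
  qed
  show thesis
  proof (cases "y 0 = 0")
    case False
    define l where "l = y 1 / y 0"
    have y: "i \<le> d \<Longrightarrow> y i = y 0 * l ^ i" for i
    proof (induction i)
      case (Suc i)
      have "y 0 * y (Suc i) = y i * y 1"
        \<comment> \<open>The relation needs distinct columns; for \<open>i = 0\<close> the equation
          is plain commutativity.\<close>
        using rel[of 0 i] Suc.prems by (cases "i = 0") simp_all
      also have "\<dots> = y 0 * (y 0 * l ^ Suc i)"
        using Suc False by (simp add: l_def)
      finally show ?case
        using False by simp
    qed simp
    have "v = y 0 \<cdot>\<^sub>v curve_vec d 1 l"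
    proof (rule eq_vecI)
      fix i assume "i < dim_vec (y 0 \<cdot>\<^sub>v curve_vec d 1 l)"
      then have "i < Suc d"
        by (simp add: curve_vec_def)
      then show "v $ i = (y 0 \<cdot>\<^sub>v curve_vec d 1 l) $ i"
        using y[of i] by (simp add: curve_vec_def vy[of i])
    qed (use v in \<open>simp add: curve_vec_def\<close>)
    with False show ?thesis
      by (intro that[of "y 0" 1 l]) simp_all
  next
    case True
    \<comment> \<open>Neighbouring columns give \<open>y i * y (i + 2) = y (i + 1) ^ 2\<close>, so
      zeros propagate up to index \<open>d - 1\<close>.\<close>
    have y: "i < d \<Longrightarrow> y i = 0" for i
    proof (induction i)
      case (Suc i)
      then show ?case
        using rel[of i "Suc i"] by simp
    qed (simp add: True)
    \<comment> \<open>\<open>0 ^ (d - i)\<close> is 0 for \<open>i < d\<close>, while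
      \<open>0 ^ 0 = 1\<close> keeps the last coordinate.\<close>
    have e: "v = y d \<cdot>\<^sub>v curve_vec d 0 1"
    proof (rule eq_vecI)
      fix i assume "i < dim_vec (y d \<cdot>\<^sub>v curve_vec d 0 1)"
      then have "i < d \<or> i = d"
        by (auto simp: curve_vec_def)
      then show "v $ i = (y d \<cdot>\<^sub>v curve_vec d 0 1) $ i"
        by (auto simp: curve_vec_def vy y)
    qed (use v in \<open>simp add: curve_vec_def\<close>)
    have "y d \<noteq> 0"
    proof
      assume "y d = 0"
      then have "v = 0\<^sub>v (Suc d)"
        using e by (auto simp: curve_vec_def)
      with v show False by simp
    qed
    with e show ?thesis
      by (intro that[of "y d" 0 1]) simp_all
  qed
qed

lemma zero_locus_minors:
  assumes "d \<ge> 2"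
  shows "zero_locus d (minors d) = {proj_pt (curve_vec d s t) | s t. (s, t) \<noteq> (0, 0)}"
proof (rule subset_antisym; rule subsetI)
  fix P assume "P \<in> zero_locus d (minors d)"
  then obtain v where v: "P = proj_pt v" "v \<in> carrier_vec (Suc d)" "v \<noteq> 0\<^sub>v (Suc d)"
      "\<And>j k. j < k \<Longrightarrow> k < d \<Longrightarrow> eval_poly (minor j k) v = 0"
    using in_proj_pt by (fastforce simp: zero_locus_def proj_space_def vanishes_at_def)
  obtain c s t where "c \<noteq> 0" "(s, t) \<noteq> (0, 0)" "v = c \<cdot>\<^sub>v curve_vec d s t"
    using zero_of_minors_on_curve[OF v(2,3) assms v(4)] by blast
  then show "P \<in> {proj_pt (curve_vec d s t) | s t. (s, t) \<noteq> (0, 0)}"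
    using v(1) proj_pt_smult by blast
next
  fix P assume "P \<in> {proj_pt (curve_vec d s t) | s t. (s, t) \<noteq> (0, 0)}"
  then obtain s t where P: "P = proj_pt (curve_vec d s t)" "(s, t) \<noteq> (0, 0)"
    by blast
  have "P \<in> proj_space d"
    unfolding proj_space_def P(1) using curve_vec_nonzero[OF P(2)]
    by (auto simp: curve_vec_def)
  moreover have "vanishes_at f P" if "f \<in> minors d" for f
    using that minor_zero_on_curve unfolding vanishes_at_def P(1) proj_pt_def by force
  ultimately show "P \<in> zero_locus d (minors d)"
    by (simp add: zero_locus_def)
qed

section \<open>Zariski closure and vanishing ideal of the moment points\<close>

abbreviation moment_points :: "nat \<Rightarrow> complex vec set set" where
  "moment_points d \<equiv> {proj_pt (vec (Suc d) (\<lambda>i. exp_moment i l)) | l. True}"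

lemma moment_points_subset_zero_locus:
  assumes "d \<ge> 2"
  shows "moment_points d \<subseteq> zero_locus d (minors d)"
proof clarify
  fix l
  have "vec (Suc d) (\<lambda>i. exp_moment i l) = curve_vec d 1 l"
    by (simp add: curve_vec_def exp_moment_def)
  then show "proj_pt (vec (Suc d) (\<lambda>i. exp_moment i l)) \<in> zero_locus d (minors d)"
    unfolding zero_locus_minors[OF assms] by (metis (mono_tags, lifting) mem_Collect_eq one_neq_zero prod.inject)
qed

lemma vanishing_on_moment_points_in_genideal:
  assumes "f \<in> homogeneous_polys d" "\<And>P. P \<in> moment_points d \<Longrightarrow> vanishes_at f P"
  shows "f \<in> Idl\<^bsub>poly_ring d\<^esub> (minors d)"
proof (rule minor_ideal.homogeneous_vanishing_in_I[OF minor_ideal_genideal])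
  show "f \<in> ring_carrier d" "homogeneous f"
    using assms(1) by (simp_all add: homogeneous_polys_def)
  show "eval_poly f (vec (Suc d) (\<lambda>i. exp_moment i l)) = 0" for l
    using assms(2) in_proj_pt unfolding vanishes_at_def by blast
qed

lemma genideal_vanishes_on_zero_locus:
  assumes "f \<in> Idl\<^bsub>poly_ring d\<^esub> (minors d)" "P \<in> zero_locus d (minors d)"
  shows "vanishes_at f P"
  unfolding vanishes_at_def
proof
  fix v assume v: "v \<in> P"
  show "eval_poly f v = 0"
    by (rule eval_genideal_zero[OF minors_carrier _ assms(1)])
       (use assms(2) v in \<open>auto simp: zero_locus_def vanishes_at_def\<close>)
qed

text \<open>A form that vanishes at all moment points lies in the ideal of the minors, hence
  vanishes on their whole zero locus. So every closed set through the moment points contains that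
  locus, and the point at infinity needs no limit argument.\<close>

lemma exp_moment_variety_eq:
  assumes "d \<ge> 2"
  shows "exp_moment_variety d = zero_locus d (minors d)"
  unfolding exp_moment_variety_def
proof (rule hull_unique)
  show "moment_points d \<subseteq> zero_locus d (minors d)"
    by (rule moment_points_subset_zero_locus[OF assms])
  show "zariski_closed d (zero_locus d (minors d))"
    unfolding zariski_closed_def using minors_homogeneous_polys by blast
  fix Z assume Z: "moment_points d \<subseteq> Z" "zariski_closed d Z"
  then obtain T where T: "T \<subseteq> homogeneous_polys d" "Z = zero_locus d T"
    unfolding zariski_closed_def by blast
  have "T \<subseteq> Idl\<^bsub>poly_ring d\<^esub> (minors d)"
    using vanishing_on_moment_points_in_genideal Z(1) T by (auto simp: zero_locus_def subset_iff)
  then show "zero_locus d (minors d) \<subseteq> Z"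
    using genideal_vanishes_on_zero_locus unfolding T(2) by (auto simp: zero_locus_def)
qed

text \<open>Each generating set lies in the ideal of the other: forms vanishing on the locus vanish
  at the moment points, and the minors are themselves such forms.\<close>

lemma vanishing_ideal_eq:
  assumes "d \<ge> 2"
  shows "vanishing_ideal d (exp_moment_variety d) = Idl\<^bsub>poly_ring d\<^esub> (minors d)"
proof -
  let ?I = "Idl\<^bsub>poly_ring d\<^esub> (minors d)"
  let ?V = "{f \<in> homogeneous_polys d. \<forall>P \<in> zero_locus d (minors d). vanishes_at f P}"
  have V: "?V \<subseteq> ring_carrier d"
    by (auto simp: homogeneous_polys_def)
  have "?V \<subseteq> ?I"
    using vanishing_on_moment_points_in_genideal moment_points_subset_zero_locus[OF assms] by blast
  then have "Idl\<^bsub>poly_ring d\<^esub> ?V \<subseteq> ?I"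
    by (rule ring.genideal_minimal[OF ring_poly_ring minor_ideal.ideal_I[OF minor_ideal_genideal]])
  moreover have "minors d \<subseteq> ?V"
    using minors_homogeneous_polys unfolding zero_locus_def by blast
  then have "?I \<subseteq> Idl\<^bsub>poly_ring d\<^esub> ?V"
    using ring.genideal_self[OF ring_poly_ring V]
    by (intro ring.genideal_minimal[OF ring_poly_ring ring.genideal_ideal[OF ring_poly_ring V]]) blast
  ultimately show ?thesis
    unfolding vanishing_ideal_def exp_moment_variety_eq[OF assms] by blast
qed

section \<open>Projective equivalence with the standard curve\<close>

lemma image_proj_pt:
  assumes "A \<in> carrier_mat n m" "v \<in> carrier_vec m"
  shows "(\<lambda>u. A *\<^sub>v u) ` proj_pt v = proj_pt (A *\<^sub>v v)"
proof -
  have "proj_pt w = (\<lambda>c. c \<cdot>\<^sub>v w) ` {c. c \<noteq> 0}" for w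
    by (auto simp: proj_pt_def)
  then show ?thesis
    by (simp add: image_image mult_mat_vec[OF assms])
qed

lemma rational_normal_curve_exp_moment_variety:
  assumes "d \<ge> 2"
  shows "rational_normal_curve d (exp_moment_variety d)"
  unfolding rational_normal_curve_def projectively_equivalent_def
proof (intro bexI conjI)
  let ?A = "mat_diag (Suc d) fact :: complex mat"
  let ?B = "mat_diag (Suc d) (\<lambda>i. 1 / fact i) :: complex mat"
  let ?u = "\<lambda>s t. vec (Suc d) (\<lambda>i. s ^ (d - i) * t ^ i) :: complex vec"
  show A: "?A \<in> carrier_mat (Suc d) (Suc d)"
    by simp
  have "?A * ?B = 1\<^sub>m (Suc d)" "?B * ?A = 1\<^sub>m (Suc d)"
    by (simp_all add: mat_diag_one)
  then show "invertible_mat ?A"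
    unfolding invertible_mat_def inverts_mat_def by (auto simp: mat_diag_def)
  have "?A *\<^sub>v ?u s t = curve_vec d s t" for s t
  proof (rule eq_vecI)
    fix i assume "i < dim_vec (curve_vec d s t)"
    then show "(?A *\<^sub>v ?u s t) $ i = curve_vec d s t $ i"
      by (simp add: curve_vec_def mat_diag_def scalar_prod_def if_distrib[of "\<lambda>x. x * _"] cong: if_cong)
  qed (simp add: curve_vec_def mat_diag_def)
  then have image: "(\<lambda>v. ?A *\<^sub>v v) ` proj_pt (?u s t) = proj_pt (curve_vec d s t)" for s t
    using image_proj_pt[OF A] by simp
  \<comment> \<open>Writing the two-parameter families as images over pairs lets the maps be
    composed by \<open>image_image\<close>.\<close>
  have setcompr: "{F s t | s t. (s, t) \<noteq> (0, 0)} = (\<lambda>p. F (fst p) (snd p)) ` (- {(0, 0)})"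
    for F :: "complex \<Rightarrow> complex \<Rightarrow> complex vec set"
    by force
  show "exp_moment_variety d = (\<lambda>P. (\<lambda>v. ?A *\<^sub>v v) ` P) ` standard_rational_normal_curve d"
    unfolding exp_moment_variety_eq[OF assms] zero_locus_minors[OF assms]
      standard_rational_normal_curve_def setcompr image_image[of "image _"] image ..
qed

theorem proposition4p8:
  fixes d :: nat
  assumes "d \<ge> 2"
  shows "vanishing_ideal d (exp_moment_variety d) =
           Idl\<^bsub>poly_ring d\<^esub> (maximal_minors (H_exp d)) \<and>
         rational_normal_curve d (exp_moment_variety d)"
  using vanishing_ideal_eq[OF assms] rational_normal_curve_exp_moment_variety[OF assms]
  by (simp add: maximal_minors_H_exp[OF assms])

end
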